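(* Let $k$ be a field of characteristic zero, let $Y = \begin{bmatrix} a_1 & a_2 \\ b_1 & b_2 \end{bmatrix}$ be a matrix of indeterminates, and let $\mathrm{SL}_2(k)$ act on $k[Y] = k[a_1, a_2, b_1, b_2]$ by $k$-algebra automorphisms, where $M \in \mathrm{SL}_2(k)$ acts by $Y \mapsto MY$. Put $\Delta_{i,j} := a_i b_j - a_j b_i$, and let $\mathcal{R} \colon k[Y] \to k[Y]^{\mathrm{SL}_2(k)} = k[\Delta_{1,2}]$ be the Reynolds operator. Let $\mu \in k[Y]$ be a monomial. (a) If $\mu = (a_1 b_2)^n (a_2 b_1)^m$ for some nonnegative integers $n$ and $m$, then $$\mathcal{R}(\mu) = \mathcal{R}\left((a_1 b_2)^n (a_2 b_1)^m\right) = \frac{n!\, m!}{(n + m + 1)!}\, \Delta_{1,2}^n\, \Delta_{2,1}^m;$$ in particular, for $n \ge 0$, $\mathcal{R}\left((a_1 b_2)^n\right) = \frac{1}{n+1} \Delta_{1,2}^n$. (b) If $\mu$ is not of the form in (a), then $\mathcal{R}(\mu) = 0$.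
   Context: The action "$Y \mapsto MY$" means that each entry $[Y]_{ij}$ is sent to $[MY]_{ij}$. The Reynolds operator for the action of $G = \mathrm{SL}_2(k)$ on $S = k[Y]$ is the unique $k$-linear map $\mathcal{R} \colon S \to S^G$ with $\mathcal{R}(r) = r$ for all $r \in S^G$ and $\mathcal{R}(g(s)) = \mathcal{R}(s)$ for all $g \in G$, $s \in S$; it exists and is unique because $\mathrm{SL}_2(k)$ is linearly reductive in characteristic zero, and it is $S^G$-linear. A monomial is a product of nonnegative powers of the variables (with coefficient $1$). *)

theory Defs
  imports "HOL-Analysis.Determinants" "HOL-Library.Poly_Mapping"
    "HOL-Computational_Algebra.Polynomial"
begin

text \<open>
  The polynomial ring \<open>k[Y]\<close> is the monoid algebra over \<open>k\<close> of the exponent vectors; the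
  variables are indexed by the positions \<open>(i, j)\<close> of the \<open>2 \<times> 2\<close> matrix \<open>Y\<close>, where the two elements
  of the index type \<open>2\<close> are written \<open>1\<close> and \<open>2\<close> as usual (the latter coincides with \<open>0\<close>).
\<close>

type_synonym 'k kY = "(2 \<times> 2 \<Rightarrow>\<^sub>0 nat) \<Rightarrow>\<^sub>0 'k"

definition Const :: "'k::field \<Rightarrow> 'k kY" where
  "Const c = Poly_Mapping.single 0 c"

definition Ymat :: "'k::field kY ^ 2 ^ 2" where
  "Ymat = (\<chi> i j. Poly_Mapping.single (Poly_Mapping.single (i, j) 1) 1)"

abbreviation avar :: "2 \<Rightarrow> 'k::field kY" where
  "avar j \<equiv> Ymat $ 1 $ j"

abbreviation bvar :: "2 \<Rightarrow> 'k::field kY" where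
  "bvar j \<equiv> Ymat $ 2 $ j"

definition Delta :: "2 \<Rightarrow> 2 \<Rightarrow> 'k::field kY" where
  "Delta i j = avar i * bvar j - avar j * bvar i"

definition is_monomial :: "'k::field kY \<Rightarrow> bool" where
  "is_monomial p \<longleftrightarrow> (\<exists>e :: 2 \<Rightarrow> 2 \<Rightarrow> nat. p = (\<Prod>i\<in>UNIV. \<Prod>j\<in>UNIV. Ymat $ i $ j ^ e i j))"

text \<open>The \<open>k\<close>-algebra endomorphism of \<open>k[Y]\<close> sending each entry of \<open>Y\<close> to that of \<open>Z\<close>.\<close>

definition subst_matrix :: "'k::field kY ^ 2 ^ 2 \<Rightarrow> 'k kY \<Rightarrow> 'k kY" where
  "subst_matrix Z p =
     (\<Sum>m\<in>Poly_Mapping.keys p. Const (Poly_Mapping.lookup p m) *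
        (\<Prod>i\<in>UNIV. \<Prod>j\<in>UNIV. Z $ i $ j ^ Poly_Mapping.lookup m (i, j)))"

definition SL2 :: "('k::field ^ 2 ^ 2) set" where
  "SL2 = {M. det M = 1}"

definition act :: "'k::field ^ 2 ^ 2 \<Rightarrow> 'k kY \<Rightarrow> 'k kY" where
  "act M = subst_matrix (map_matrix Const M ** Ymat)"

definition invariants :: "'k::field kY set" where
  "invariants = {p. \<forall>M\<in>SL2. act M p = p}"

definition is_reynolds :: "('k::field kY \<Rightarrow> 'k kY) \<Rightarrow> bool" where
  "is_reynolds R \<longleftrightarrow>
     Vector_Spaces.linear (\<lambda>c p. Const c * p) (\<lambda>c p. Const c * p) R \<and>
     range R \<subseteq> invariants \<and>
     (\<forall>r\<in>invariants. R r = r) \<and>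
     (\<forall>M\<in>SL2. \<forall>s. R (act M s) = R s)"

definition reynolds :: "'k::field kY \<Rightarrow> 'k kY" where
  "reynolds = (THE R. is_reynolds R)"

text \<open>The subalgebra \<open>k[f]\<close> generated by \<open>f\<close>, as the image of \<open>k[t]\<close> under \<open>t \<mapsto> f\<close>.\<close>

definition generated_subalgebra :: "'k::field kY \<Rightarrow> 'k kY set" where
  "generated_subalgebra f = range (\<lambda>q :: 'k poly. poly (map_poly Const q) f)"

end

theory Submission
  imports Defs
begin

text \<open>
  Let \<open>L\<close> be linear with \<open>L (g s) = L s\<close> for all \<open>g\<close> in \<open>SL\<^sub>2\<close>. The torus shows that \<open>L\<close> kills all
  monomials of nonzero weight, and a unipotent element then gives \<open>L \<circ> F = 0\<close> for the lowering
  operator \<open>F = b\<^sub>1 \<partial>/\<partial>a\<^sub>1 + b\<^sub>2 \<partial>/\<partial>a\<^sub>2\<close>. On monomials this is a two-term recurrence, which forces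
  \<open>L \<mu> = 0\<close> unless \<open>\<mu> = (a\<^sub>1 b\<^sub>2)\<^sup>n (a\<^sub>2 b\<^sub>1)\<^sup>m\<close> and determines \<open>L\<close> on these from \<open>L ((a\<^sub>1 b\<^sub>2)\<^sup>N)\<close>, hence
  from \<open>L (\<Delta>\<^sup>N)\<close>, \<open>N = n + m\<close>. This gives uniqueness and the formula. The coefficients of an
  invariant, weighted by factorials, satisfy the same recurrence, so the invariants are \<open>k[\<Delta>]\<close>.
  For existence, Cayley's operator \<open>\<Omega> = \<partial>\<^sup>2/\<partial>a\<^sub>1\<partial>b\<^sub>2 - \<partial>\<^sup>2/\<partial>a\<^sub>2\<partial>b\<^sub>1\<close> commutes with \<open>SL\<^sub>2\<close> and
  \<open>\<Omega> \<Delta>\<^sup>N = N (N + 1) \<Delta>\<^sup>N\<^sup>-\<^sup>1\<close>, so that \<open>\<Sum>\<^sub>N (\<Omega>\<^sup>N s)(0) / (N! (N + 1)!) \<Delta>\<^sup>N\<close> is a Reynolds operator.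
\<close>

subsection \<open>Polynomials and substitutions\<close>

lemma Const_0 [simp]: "Const 0 = 0" and Const_1 [simp]: "Const 1 = 1"
  by (simp_all add: Const_def)

lemma Const_add: "Const (a + b) = Const a + Const b"
  by (simp add: Const_def single_add)

lemma Const_uminus: "Const (- a) = - Const a"
  by (simp add: Const_def single_uminus)

lemma Const_diff: "Const (a - b) = Const a - Const b"
  by (simp add: Const_def single_diff)

lemma Const_mult: "Const (a * b) = Const a * Const b"
  by (simp add: Const_def mult_single)

lemma Const_power: "Const (a ^ n) = Const a ^ n"
  by (induction n) (simp_all add: Const_mult)

lemma Const_of_nat: "Const (of_nat n) = of_nat n"
  by (simp add: Const_def)

lemma Const_numeral: "Const (numeral n) = numeral n"
  by (simp add: Const_def)

lemma lookup_Const_mult: "Poly_Mapping.lookup (Const c * p) m = c * Poly_Mapping.lookup p m"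
  unfolding Const_def mult_map_scale_conv_mult[symmetric]
  by (simp add: map.rep_eq when_def)

lemma kY_eq_sum:
  "p = (\<Sum>m\<in>Poly_Mapping.keys p. Const (Poly_Mapping.lookup p m) * Poly_Mapping.single m 1)"
proof (rule poly_mapping_eqI)
  fix m
  have "(\<Sum>n\<in>Poly_Mapping.keys p. Poly_Mapping.lookup p n * (1 when n = m)) =
      (\<Sum>n\<in>Poly_Mapping.keys p. if n = m then Poly_Mapping.lookup p n else 0)"
    by (rule sum.cong) (simp_all add: when_def)
  then show "Poly_Mapping.lookup p m = Poly_Mapping.lookup (\<Sum>m\<in>Poly_Mapping.keys p. Const (Poly_Mapping.lookup p m) * Poly_Mapping.single m 1) m"
    by (simp add: lookup_sum lookup_Const_mult lookup_single in_keys_iff)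
qed

abbreviation ymono :: "nat \<Rightarrow> nat \<Rightarrow> nat \<Rightarrow> nat \<Rightarrow> 'k::field kY" where
  "ymono i j k l \<equiv> avar 1 ^ i * avar 2 ^ j * bvar 1 ^ k * bvar 2 ^ l"

definition expo :: "nat \<Rightarrow> nat \<Rightarrow> nat \<Rightarrow> nat \<Rightarrow> 2 \<times> 2 \<Rightarrow>\<^sub>0 nat" where
  "expo i j k l = Poly_Mapping.single (1, 1) i + Poly_Mapping.single (1, 2) j +
     Poly_Mapping.single (2, 1) k + Poly_Mapping.single (2, 2) l"

lemma lookup_expo [simp]:
  "Poly_Mapping.lookup (expo i j k l) (1, 1) = i" "Poly_Mapping.lookup (expo i j k l) (1, 2) = j"
  "Poly_Mapping.lookup (expo i j k l) (2, 1) = k" "Poly_Mapping.lookup (expo i j k l) (2, 2) = l"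
  by (simp_all add: expo_def lookup_add lookup_single)

lemma expo_iff_lookup: "m = expo i j k l \<longleftrightarrow>
    Poly_Mapping.lookup m (1, 1) = i \<and> Poly_Mapping.lookup m (1, 2) = j \<and>
    Poly_Mapping.lookup m (2, 1) = k \<and> Poly_Mapping.lookup m (2, 2) = l"
proof (intro iffI poly_mapping_eqI)
  fix u :: "2 \<times> 2"
  assume "Poly_Mapping.lookup m (1, 1) = i \<and> Poly_Mapping.lookup m (1, 2) = j \<and>
    Poly_Mapping.lookup m (2, 1) = k \<and> Poly_Mapping.lookup m (2, 2) = l"
  moreover have "u = (1, 1) \<or> u = (1, 2) \<or> u = (2, 1) \<or> u = (2, 2)"
    using exhaust_2[of "fst u"] exhaust_2[of "snd u"] by (metis prod.collapse)
  ultimately show "Poly_Mapping.lookup m u = Poly_Mapping.lookup (expo i j k l) u"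
    by auto
qed auto

lemma expo_eq_iff [simp]: "expo i j k l = expo i' j' k' l' \<longleftrightarrow> i = i' \<and> j = j' \<and> k = k' \<and> l = l'"
  by (auto simp: expo_iff_lookup)

lemma expo_cases: obtains i j k l where "m = expo i j k l"
  using expo_iff_lookup by blast

lemma Ymat_power: "(Ymat $ i $ j) ^ n = Poly_Mapping.single (Poly_Mapping.single (i, j) n) 1"
proof (induction n)
  case (Suc n)
  have "Poly_Mapping.single (i, j) (1::nat) + Poly_Mapping.single (i, j) n =
      Poly_Mapping.single (i, j) (Suc n)"
    by (simp flip: single_add)
  with Suc show ?case by (simp add: Ymat_def mult_single)
qed simp

lemma ymono_eq_single: "ymono i j k l = Poly_Mapping.single (expo i j k l) 1"
  by (simp add: Ymat_power mult_single expo_def)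

lemma lookup_ymono:
  "Poly_Mapping.lookup (ymono i j k l) m = (if m = expo i j k l then 1 else 0)"
  by (auto simp: ymono_eq_single lookup_single)

text \<open>Every monomial is built from a constant by multiplying by one variable at a time.
  Identities for ring homomorphisms and derivations thus need checking only for a single variable
  factor.\<close>

lemma kY_induct [case_names Const var_mult add]:
  assumes Const: "\<And>c. P (Const c)"
    and var: "\<And>i j p. P p \<Longrightarrow> P (Ymat $ i $ j * p)"
    and add: "\<And>p q. P p \<Longrightarrow> P q \<Longrightarrow> P (p + q)"
  shows "P (p :: 'k::field kY)"
proof -
  have pow: "P (Ymat $ i $ j ^ n * q)" if "P q" for i j n q
    using that by (induction n) (simp_all add: var mult.assoc)
  have mono: "P (Const c * Poly_Mapping.single m 1)" for c m
  proof -
    obtain i j k l where "m = expo i j k l" by (rule expo_cases)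
    then have "Const c * Poly_Mapping.single m 1 =
        avar 1 ^ i * (avar 2 ^ j * (bvar 1 ^ k * (bvar 2 ^ l * Const c)))"
      by (simp add: ymono_eq_single[symmetric] mult_ac)
    then show ?thesis by (simp add: pow Const)
  qed
  have "P (\<Sum>m\<in>A. Const (f m) * Poly_Mapping.single m 1)" for A f
    by (induction A rule: infinite_finite_induct) (simp_all add: add mono Const[of 0, simplified])
  then show ?thesis by (subst kY_eq_sum) simp
qed

definition linear_map :: "('k::field kY \<Rightarrow> 'k kY) \<Rightarrow> bool" where
  "linear_map L \<longleftrightarrow> (\<forall>p q. L (p + q) = L p + L q) \<and> (\<forall>c p. L (Const c * p) = Const c * L p)"

lemma linear_iff_linear_map:
  fixes L :: "'k::field kY \<Rightarrow> 'k kY"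
  shows "Vector_Spaces.linear (\<lambda>c p. Const c * p) (\<lambda>c p. Const c * p) L \<longleftrightarrow> linear_map L"
proof -
  have "vector_space (\<lambda>c p :: 'k kY. Const c * p)"
    by unfold_locales (simp_all add: Const_add Const_mult algebra_simps)
  then show ?thesis by (simp add: Vector_Spaces.linear_iff linear_map_def)
qed

context
  fixes L :: "'k::field kY \<Rightarrow> 'k kY"
  assumes L: "linear_map L"
begin

lemma linear_map_add: "L (p + q) = L p + L q" and linear_map_scale: "L (Const c * p) = Const c * L p"
  using L by (simp_all add: linear_map_def)

lemma linear_map_scale_right: "L (p * Const c) = L p * Const c"
  using linear_map_scale[of c p] by (simp add: mult.commute)

lemma linear_map_0: "L 0 = 0"
  using linear_map_scale[of 0] by simp

lemma linear_map_uminus: "L (- p) = - L p"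
  using linear_map_scale[of "-1" p] by (simp add: Const_uminus)

lemma linear_map_diff: "L (p - q) = L p - L q"
  using linear_map_add[of p "- q"] by (simp add: linear_map_uminus)

lemma linear_map_sum: "L (sum f A) = (\<Sum>x\<in>A. L (f x))"
  by (induction A rule: infinite_finite_induct) (simp_all add: linear_map_0 linear_map_add)

end

text \<open>The monomials span \<open>k[Y]\<close>. This is the standard way below to prove
  identities that are linear in one polynomial.\<close>

lemma linear_map_eqI:
  assumes "linear_map L" "linear_map L'" and mono: "\<And>i j k l. L (ymono i j k l) = L' (ymono i j k l)"
  shows "L p = L' p"
proof -
  have "L (Poly_Mapping.single m 1) = L' (Poly_Mapping.single m 1)" for m
    using mono expo_cases[of m] by (metis ymono_eq_single)
  then show ?thesis
    by (subst (1 2) kY_eq_sum)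
      (simp add: linear_map_sum linear_map_scale assms(1,2))
qed

section \<open>Substitution as an algebra homomorphism\<close>

definition subst_mono :: "'k::field kY ^ 2 ^ 2 \<Rightarrow> (2 \<times> 2 \<Rightarrow>\<^sub>0 nat) \<Rightarrow> 'k kY" where
  "subst_mono Z m = (\<Prod>i\<in>UNIV. \<Prod>j\<in>UNIV. Z $ i $ j ^ Poly_Mapping.lookup m (i, j))"

text \<open>Extra exponents contribute zero terms. A common index set lets sums for different
  polynomials be added termwise, although supports may shrink by cancellation.\<close>

lemma subst_matrix_superset:
  assumes "finite A" "Poly_Mapping.keys p \<subseteq> A"
  shows "subst_matrix Z p = (\<Sum>m\<in>A. Const (Poly_Mapping.lookup p m) * subst_mono Z m)"
  unfolding subst_matrix_def subst_mono_def
  by (rule sum.mono_neutral_left) (use assms in \<open>auto simp: in_keys_iff\<close>)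

lemma linear_map_subst_matrix: "linear_map (subst_matrix (Z :: 'a::field kY ^ 2 ^ 2))"
  unfolding linear_map_def
proof (intro allI conjI)
  fix p q :: "'a kY"
  let ?A = "Poly_Mapping.keys p \<union> Poly_Mapping.keys q"
  have "finite ?A" "Poly_Mapping.keys (p + q) \<subseteq> ?A" by (simp_all add: keys_add)
  then show "subst_matrix Z (p + q) = subst_matrix Z p + subst_matrix Z q"
    by (simp add: subst_matrix_superset[where A = ?A] lookup_add Const_add sum.distrib distrib_right)
next
  fix c and p :: "'a kY"
  have "Poly_Mapping.keys (Const c * p) \<subseteq> Poly_Mapping.keys p"
    by (auto simp: in_keys_iff lookup_Const_mult)
  then show "subst_matrix Z (Const c * p) = Const c * subst_matrix Z p"
    by (simp add: subst_matrix_superset[where A = "Poly_Mapping.keys p"] lookup_Const_mult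
        Const_mult sum_distrib_left mult.assoc)
qed

lemmas subst_matrix_add = linear_map_add[OF linear_map_subst_matrix]
lemmas subst_matrix_scale = linear_map_scale[OF linear_map_subst_matrix]
lemmas subst_matrix_diff = linear_map_diff[OF linear_map_subst_matrix]

lemma subst_matrix_single:
  "subst_matrix Z (Poly_Mapping.single m c) = Const c * subst_mono Z m"
  by (cases "c = 0") (simp_all add: subst_matrix_def subst_mono_def)

lemma subst_mono_add: "subst_mono Z (m + n) = subst_mono Z m * subst_mono Z n"
  by (simp add: subst_mono_def lookup_add power_add prod.distrib)

lemma subst_matrix_Const [simp]: "subst_matrix Z (Const c) = Const c"
  by (subst Const_def) (simp add: subst_matrix_single subst_mono_def)

lemma subst_matrix_1 [simp]: "subst_matrix Z 1 = 1"
  using subst_matrix_Const[of Z 1] by simp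

lemma subst_matrix_var [simp]: "subst_matrix Z (Ymat $ i $ j) = Z $ i $ j"
proof -
  have "subst_mono Z (Poly_Mapping.single (i, j) 1) = Z $ i $ j"
    using exhaust_2[of i] exhaust_2[of j]
    by (auto simp: subst_mono_def UNIV_2 lookup_single)
  then show ?thesis
    by (simp add: Ymat_def subst_matrix_single)
qed

text \<open>Both sides are bilinear, so the law for monomials, which is
  \<open>subst_mono_add\<close>, suffices. The fact \<open>right\<close> extends it to an arbitrary
  first factor, the last step to an arbitrary second one.\<close>

lemma subst_matrix_mult:
  fixes p :: "'a::field kY"
  shows "subst_matrix Z (p * q) = subst_matrix Z p * subst_matrix Z q"
proof -
  have single: "subst_matrix Z (Poly_Mapping.single m 1 * Poly_Mapping.single n 1) =
      subst_matrix Z (Poly_Mapping.single m 1) * subst_matrix Z (Poly_Mapping.single n 1)" for m n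
    by (simp add: mult_single subst_matrix_single subst_mono_add)
  have right: "subst_matrix Z (q * Poly_Mapping.single n 1) =
      subst_matrix Z q * subst_matrix Z (Poly_Mapping.single n 1)" for q n
  proof (rule linear_map_eqI[where L = "\<lambda>q. subst_matrix Z (q * Poly_Mapping.single n 1)"
        and L' = "\<lambda>q. subst_matrix Z q * subst_matrix Z (Poly_Mapping.single n 1)"])
    show "linear_map (\<lambda>q. subst_matrix Z (q * Poly_Mapping.single n 1))"
      "linear_map (\<lambda>q. subst_matrix Z q * subst_matrix Z (Poly_Mapping.single n 1))"
      by (simp_all add: linear_map_def subst_matrix_add subst_matrix_scale distrib_right mult.assoc)
  qed (simp only: ymono_eq_single single)
  have scale: "p * (Const c * q) = Const c * (p * q)" for c q
    by (rule mult.left_commute)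
  show ?thesis
  proof (rule linear_map_eqI[where L = "\<lambda>q. subst_matrix Z (p * q)"
        and L' = "\<lambda>q. subst_matrix Z p * subst_matrix Z q"])
    show "linear_map (\<lambda>q. subst_matrix Z (p * q))"
      by (simp add: linear_map_def subst_matrix_add subst_matrix_scale distrib_left scale)
    show "linear_map (\<lambda>q. subst_matrix Z p * subst_matrix Z q)"
      by (simp add: linear_map_def subst_matrix_add subst_matrix_scale distrib_left
          mult.left_commute[of _ "Const _"])
  qed (simp only: ymono_eq_single right)
qed

lemma subst_matrix_power: "subst_matrix Z (p ^ n) = subst_matrix Z p ^ n"
  by (induction n) (simp_all add: subst_matrix_mult)

lemma subst_matrix_subst_matrix:
  "subst_matrix Z (subst_matrix W p) = subst_matrix (map_matrix (subst_matrix Z) W) p"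
  by (induction p rule: kY_induct) (simp_all add: subst_matrix_mult subst_matrix_add)

subsection \<open>Partial derivatives and the Cayley operator\<close>

text \<open>Coefficients are read off from the target exponent \<open>m\<close>, which can only come
  from differentiating \<open>m + Poly_Mapping.single u 1\<close>; this avoids truncated
  subtraction.\<close>

definition pd :: "2 \<times> 2 \<Rightarrow> 'k::field kY \<Rightarrow> 'k kY" where
  "pd u p = Abs_poly_mapping
     (\<lambda>m. of_nat (Poly_Mapping.lookup m u + 1) * Poly_Mapping.lookup p (m + Poly_Mapping.single u 1))"

lemma lookup_pd: "Poly_Mapping.lookup (pd u p) m =
    of_nat (Poly_Mapping.lookup m u + 1) * Poly_Mapping.lookup p (m + Poly_Mapping.single u 1)"
proof -
  \<comment> \<open>The shift is injective, so the preimage of the finite support is finite and the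
    argument of \<open>Abs_poly_mapping\<close> has finite support.\<close>
  have "finite ((\<lambda>m. m + Poly_Mapping.single u 1) -` Poly_Mapping.keys p)"
    by (rule finite_vimageI) (simp_all add: inj_on_def)
  then have "finite {m. of_nat (Poly_Mapping.lookup m u + 1) *
      Poly_Mapping.lookup p (m + Poly_Mapping.single u 1) \<noteq> 0}"
    by (rule finite_subset[rotated]) (auto simp: in_keys_iff)
  then show ?thesis by (simp add: pd_def)
qed

lemma linear_map_pd: "linear_map (pd u)"
  by (auto simp: linear_map_def lookup_pd lookup_add lookup_Const_mult distrib_left mult_ac(3)
      intro!: poly_mapping_eqI)

lemmas pd_add = linear_map_add[OF linear_map_pd]
lemmas pd_scale = linear_map_scale[OF linear_map_pd] linear_map_scale_right[OF linear_map_pd]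
lemmas pd_diff = linear_map_diff[OF linear_map_pd]
lemmas pd_uminus = linear_map_uminus[OF linear_map_pd]
lemmas pd_0 = linear_map_0[OF linear_map_pd]

lemma pd_commute: "pd u (pd v p) = pd v (pd u p)"
  by (cases "u = v")
    (auto simp: lookup_pd lookup_add lookup_single when_def algebra_simps intro!: poly_mapping_eqI)

lemma pd_single: "pd u (Poly_Mapping.single n 1) =
    Poly_Mapping.single (n - Poly_Mapping.single u 1) (of_nat (Poly_Mapping.lookup n u))"
proof (rule poly_mapping_eqI)
  fix m
  show "Poly_Mapping.lookup (pd u (Poly_Mapping.single n 1)) m = Poly_Mapping.lookup
      (Poly_Mapping.single (n - Poly_Mapping.single u 1) (of_nat (Poly_Mapping.lookup n u))) m"
  proof (cases "n = m + Poly_Mapping.single u 1")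
    case True
    then show ?thesis by (simp add: lookup_pd lookup_add)
  next
    case False
    \<comment> \<open>Truncated subtraction can reach \<open>m\<close> from a wrong \<open>n\<close>
      only when the exponent of \<open>u\<close> in \<open>n\<close> is 0, and then the coefficient
      vanishes.\<close>
    have "Poly_Mapping.lookup n u = 0" if "n - Poly_Mapping.single u 1 = m"
    proof (rule ccontr)
      assume "Poly_Mapping.lookup n u \<noteq> 0"
      then have "n = (n - Poly_Mapping.single u 1) + Poly_Mapping.single u 1"
        by (intro poly_mapping_eqI) (auto simp: lookup_add lookup_minus lookup_single when_def)
      with False that show False by simp
    qed
    with False show ?thesis by (auto simp: lookup_pd lookup_single when_def)
  qed
qed

lemma pd_var_mult:
  fixes p :: "'k::field kY"
  shows "pd u (Ymat $ i $ j * p) = (if u = (i, j) then p else 0) + Ymat $ i $ j * pd u p"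
proof (rule linear_map_eqI[where L = "\<lambda>p. pd u (Ymat $ i $ j * p)"
      and L' = "\<lambda>p. (if u = (i, j) then p else 0) + Ymat $ i $ j * pd u p"])
  show "linear_map (\<lambda>p. pd u (Ymat $ i $ j * p))"
    by (simp add: linear_map_def pd_add pd_scale distrib_left mult.left_commute)
  show "linear_map (\<lambda>p. (if u = (i, j) then p else 0) + Ymat $ i $ j * pd u p)"
    by (simp add: linear_map_def pd_add pd_scale algebra_simps)
  fix a b c d
  define n where "n = expo a b c d"
  let ?e = "\<lambda>u. Poly_Mapping.single u (1::nat)"
  have *: "?e v + n - ?e u = ?e v + (n - ?e u)" if "Poly_Mapping.lookup n u \<noteq> 0" for u v
    using that
    by (intro poly_mapping_eqI) (auto simp: lookup_add lookup_minus lookup_single when_def)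
  have "pd u (Poly_Mapping.single (?e (i, j)) (1 :: 'k) * Poly_Mapping.single n 1) =
     (if u = (i, j) then Poly_Mapping.single n 1 else 0) +
      Poly_Mapping.single (?e (i, j)) 1 * pd u (Poly_Mapping.single n 1)"
    using *[of u "(i, j)"] *[of u u]
    by (cases "Poly_Mapping.lookup n u = 0")
      (auto simp: mult_single pd_single lookup_add lookup_single single_add)
  then show "pd u (Ymat $ i $ j * ymono a b c d) =
     (if u = (i, j) then ymono a b c d :: 'k kY else 0) + Ymat $ i $ j * pd u (ymono a b c d)"
    by (simp add: Ymat_def[THEN arg_cong[where f = "\<lambda>M. M $ i $ j"]] n_def[symmetric] ymono_eq_single
        cong: if_cong split del: if_split)
qed

lemma pd_Const [simp]: "pd u (Const c) = 0"
  by (rule poly_mapping_eqI) (auto simp: lookup_pd Const_def lookup_single when_def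
      dest!: arg_cong[where f = "\<lambda>m. Poly_Mapping.lookup m u"] simp: lookup_add)

lemma pd_1 [simp]: "pd u 1 = 0"
  using pd_Const[of u 1] by simp

lemma pd_of_nat [simp]: "pd u (of_nat n) = 0"
  using pd_Const[of u "of_nat n"] by (simp add: Const_of_nat)

lemma pd_var [simp]: "pd u (Ymat $ i $ j) = (if u = (i, j) then 1 else 0)"
  using pd_var_mult[of u i j 1] by simp

lemma pd_mult: "pd u (p * q) = pd u p * q + p * pd u q"
  by (induction p rule: kY_induct)
    (simp_all add: pd_scale pd_add pd_var_mult mult.assoc distrib_left distrib_right)

lemma pd_power: "pd u (p ^ n) = of_nat n * p ^ (n - 1) * pd u p"
proof (induction n)
  case (Suc n)
  then show ?case by (cases n) (simp_all add: pd_mult algebra_simps)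
qed simp

section \<open>Equivariance of the Cayley operator\<close>

lemma linear_map_act: "linear_map (act M)"
  unfolding act_def by (rule linear_map_subst_matrix)

lemma act_add: "act M (p + q) = act M p + act M q"
  and act_scale: "act M (Const c * p) = Const c * act M p"
  and act_diff: "act M (p - q) = act M p - act M q"
  and act_mult: "act M (p * q) = act M p * act M q"
  and act_power: "act M (p ^ n) = act M p ^ n"
  and act_Const [simp]: "act M (Const c) = Const c"
  and act_1 [simp]: "act M 1 = 1"
  by (simp_all add: act_def subst_matrix_add subst_matrix_scale subst_matrix_diff
      subst_matrix_mult subst_matrix_power)

lemma act_var: "act M (Ymat $ i $ j) = Const (M $ i $ 1) * avar j + Const (M $ i $ 2) * bvar j"
  by (simp add: act_def matrix_matrix_mult_def UNIV_2)

text \<open>This is the chain rule: the form substituted for the variable at \<open>(r, s)\<close>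
  has derivative \<open>M $ r $ i\<close> with respect to the variable at \<open>(i, j)\<close> if
  \<open>s = j\<close>, and 0 otherwise.\<close>

lemma pd_act: "pd (i, j) (act M p) =
    Const (M $ 1 $ i) * act M (pd (1, j) p) + Const (M $ 2 $ i) * act M (pd (2, j) p)"
proof (induction p rule: kY_induct)
  case (var_mult r s p)
  have "pd (i, j) (act M (Ymat $ r $ s)) = (if j = s then Const (M $ r $ i) else 0)"
    using exhaust_2[of i] by (auto simp: act_var pd_add pd_scale)
  with var_mult show ?case
    using exhaust_2[of r]
    by (auto simp: act_mult pd_mult pd_var_mult act_add algebra_simps linear_map_0[OF linear_map_act])
qed (simp_all add: act_add pd_add algebra_simps linear_map_0[OF linear_map_act])

definition Omega :: "'k::field kY \<Rightarrow> 'k kY" where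
  "Omega p = pd (1, 1) (pd (2, 2) p) - pd (1, 2) (pd (2, 1) p)"

lemma linear_map_Omega: "linear_map Omega"
  by (simp add: linear_map_def Omega_def pd_add pd_scale algebra_simps)

text \<open>By the chain rule the derivatives in each column transform by the transpose of
  \<open>M\<close>, so their determinant is multiplied by \<open>det M\<close>. The instances of
  \<open>pd_commute\<close> order the second derivatives so that the mixed terms cancel.\<close>

lemma Omega_act: "Omega (act M p) = Const (det M) * act M (Omega p)"
  unfolding Omega_def
  by (simp add: pd_act pd_add pd_scale act_add act_scale act_diff det_2 Const_mult Const_diff
      pd_commute[of "(2, 2)" "(1, 1)"] pd_commute[of "(2, 1)" "(1, 2)"]
      pd_commute[of "(2, 1)" "(1, 1)"] pd_commute[of "(2, 2)" "(1, 2)"] pd_commute[of "(1, 2)" "(1, 1)"]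
      pd_commute[of "(2, 2)" "(2, 1)"]  algebra_simps)

lemma act_Delta: "act M (Delta i j) = Const (det M) * Delta i j"
  by (simp add: Delta_def act_diff act_mult act_var det_2 Const_mult Const_diff algebra_simps)

lemma Omega_Delta_power:
  "Omega (Delta 1 2 ^ Suc n) = Const (of_nat ((n + 1) * (n + 2))) * Delta 1 2 ^ n"
proof (cases n)
  case 0
  then show ?thesis
    by (simp add: Omega_def Delta_def pd_diff pd_mult pd_add Const_numeral pd_0 pd_uminus)
next
  case (Suc k)
  have D: "pd (1, 1) (Delta 1 2) = bvar 2" "pd (2, 2) (Delta 1 2) = avar 1"
    "pd (1, 2) (Delta 1 2) = - bvar 1" "pd (2, 1) (Delta 1 2) = - avar 2"
    by (simp_all add: Delta_def pd_diff pd_mult)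
  \<comment> \<open>The 2 is \<open>Omega (Delta 1 2)\<close>; the last bracket collects the
    products of first derivatives and equals \<open>Delta 1 2\<close> again, which restores the
    exponent \<open>n = Suc k\<close>.\<close>
  have "Omega (Delta 1 2 ^ Suc n) = of_nat (Suc n) * (2 * Delta 1 2 ^ n +
      of_nat n * Delta 1 2 ^ k * (avar 1 * bvar 2 - avar 2 * bvar 1))"
    unfolding Omega_def pd_power
    by (simp add: pd_mult pd_power D Suc mult.assoc pd_uminus del: of_nat_Suc power_Suc)
      (simp add: algebra_simps del: of_nat_Suc)
  also have "\<dots> = of_nat (Suc n) * (2 * Delta 1 2 ^ n + of_nat n * Delta 1 2 ^ n)"
    by (simp add: Suc Delta_def mult_ac)
  also have "\<dots> = Const (of_nat ((n + 1) * (n + 2))) * Delta 1 2 ^ n"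
    by (simp only: Const_of_nat) (simp add: algebra_simps)
  finally show ?thesis .
qed

lemma subst_matrix_zero: "subst_matrix 0 p = Const (Poly_Mapping.lookup p 0)"
proof (rule linear_map_eqI[where L' = "\<lambda>p. Const (Poly_Mapping.lookup p 0)"])
  show "linear_map (\<lambda>p. Const (Poly_Mapping.lookup p 0))"
    by (simp add: linear_map_def lookup_add Const_add lookup_Const_mult Const_mult)
  show "subst_matrix 0 (ymono i j k l) = Const (Poly_Mapping.lookup (ymono i j k l) 0)" for i j k l
    by (auto simp: lookup_ymono expo_iff_lookup subst_matrix_mult subst_matrix_power power_0_left)
qed (rule linear_map_subst_matrix)

text \<open>The entries of \<open>MY\<close> are linear forms, so the substitution fixes the origin,
  and the constant coefficient is the value at the origin.\<close>

lemma lookup_0_act: "Poly_Mapping.lookup (act M p) 0 = Poly_Mapping.lookup p 0"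
proof -
  have "subst_matrix 0 (act M p) = subst_matrix 0 p"
    unfolding act_def subst_matrix_subst_matrix
    by (rule arg_cong[where f = "\<lambda>Z. subst_matrix Z p"])
      (simp add: vec_eq_iff matrix_matrix_mult_def UNIV_2 subst_matrix_add subst_matrix_mult)
  then have "Poly_Mapping.lookup (Const (Poly_Mapping.lookup (act M p) 0)) 0 =
      Poly_Mapping.lookup (Const (Poly_Mapping.lookup p 0)) 0"
    by (simp add: subst_matrix_zero)
  then show ?thesis by (simp add: Const_def)
qed

definition Omega_coeff :: "nat \<Rightarrow> 'k::field kY \<Rightarrow> 'k" where
  "Omega_coeff N p = Poly_Mapping.lookup ((Omega ^^ N) p) 0"

lemma linear_map_Omega_power: "linear_map (Omega ^^ N)"
  by (induction N) (simp_all add: linear_map_def linear_map_add[OF linear_map_Omega]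
      linear_map_scale[OF linear_map_Omega])

lemma Omega_coeff_add: "Omega_coeff N (p + q) = Omega_coeff N p + Omega_coeff N q"
  and Omega_coeff_scale: "Omega_coeff N (Const c * p) = c * Omega_coeff N p"
  by (simp_all add: Omega_coeff_def linear_map_add[OF linear_map_Omega_power] lookup_add
      linear_map_scale[OF linear_map_Omega_power] lookup_Const_mult)

lemma Omega_coeff_act:
  assumes "det M = 1"
  shows "Omega_coeff N (act M p) = Omega_coeff N p"
proof -
  have "(Omega ^^ N) (act M p) = act M ((Omega ^^ N) p)"
    by (induction N) (simp_all add: Omega_act assms)
  then show ?thesis by (simp add: Omega_coeff_def lookup_0_act)
qed

lemma Omega_coeff_Suc: "Omega_coeff (Suc N) p = Omega_coeff N (Omega p)"
  by (simp add: Omega_coeff_def funpow_swap1)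

text \<open>Each \<open>Omega\<close> lowers the exponent by one, and the product of n(n+1) for n =
  1, ..., N is N! (N+1)!. For M < N the constant 1 is reached and killed; for M > N a positive power
  of \<open>Delta 1 2\<close> is left, which vanishes at the origin.\<close>

lemma Omega_coeff_Delta_power:
  "Omega_coeff N (Delta 1 2 ^ M) = (if M = N then fact N * fact (N + 1) else 0)"
proof (induction N arbitrary: M)
  case 0
  have "subst_matrix 0 (Delta 1 2 ^ M :: 'a kY) = 0 ^ M"
    by (simp add: subst_matrix_power Delta_def subst_matrix_diff subst_matrix_mult)
  then have "Const (Poly_Mapping.lookup (Delta 1 2 ^ M :: 'a kY) 0) = Const (0 ^ M)"
    by (simp add: subst_matrix_zero Const_power)
  then have "Poly_Mapping.lookup (Delta 1 2 ^ M :: 'a kY) 0 = 0 ^ M"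
    by (metis Const_def lookup_single_eq)
  then show ?case by (simp add: Omega_coeff_def power_0_left)
next
  case (Suc N)
  show ?case
  proof (cases M)
    case 0
    have "Omega (1 :: 'a kY) = 0" by (simp add: Omega_def pd_0)
    moreover have "Omega_coeff N (0 :: 'a kY) = 0"
      using Omega_coeff_scale[of N 0 0] by simp
    ultimately show ?thesis using 0 by (simp add: Omega_coeff_Suc)
  next
    case (Suc m)
    then show ?thesis
      by (simp only: Omega_coeff_Suc Omega_Delta_power Omega_coeff_scale Suc.IH)
        (simp add: algebra_simps)
  qed
qed

subsection \<open>Invariant linear maps\<close>

text \<open>
  The sort \<open>{field,semiring_char_0}\<close> instead of \<open>field_char_0\<close>: in the formula for
  \<open>reynolds ((avar 1 * bvar 2) ^ n * (avar 2 * bvar 1) ^ m)\<close> in the theorem nothing ties the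
  coefficients to those of \<open>\<mu>\<close>, and type inference gives them a type variable of this sort.
\<close>

lemma
  fixes r :: "nat \<Rightarrow> nat \<Rightarrow> nat \<Rightarrow> nat \<Rightarrow> 'k::{field,semiring_char_0}"
  assumes weight: "\<And>i j k l. i + j \<noteq> k + l \<Longrightarrow> r i j k l = 0"
    and rec: "\<And>i j k l. i + j = k + l + 2 \<Longrightarrow>
      of_nat i * r (i - 1) j (k + 1) l + of_nat j * r i (j - 1) k (l + 1) = 0"
  shows lowering_recurrence_zero: "\<not> (i = l \<and> j = k) \<Longrightarrow> r i j k l = 0"
    and lowering_recurrence_balanced:
      "fact (n + m) * r n m m n = (- 1) ^ m * fact n * fact m * r (n + m) 0 0 (n + m)"
proof -
  \<comment> \<open>The recurrence at \<open>(i, j + 1, k, l - 1)\<close> ties \<open>j + 1\<close>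
    times this value to the one with \<open>i\<close> and \<open>l\<close> both lowered by one, so
    \<open>i < l\<close> persists. At \<open>i = 0\<close> the other term has coefficient 0.\<close>
  have less: "r i j k l = 0" if "i < l" "i + j = k + l" for i j k l
    using that
  proof (induction i arbitrary: j k l)
    case 0
    with rec[of 0 "j + 1" k "l - 1"] show ?case
      by (cases l) (auto simp flip: of_nat_Suc)
  next
    case (Suc i)
    from Suc.prems Suc.IH[of "l - 1" "j + 1" "k + 1"] have "r i (j + 1) (k + 1) (l - 1) = 0"
      by auto
    with Suc.prems rec[of "Suc i" "j + 1" k "l - 1"] show ?case
      by (cases l) (auto simp flip: of_nat_Suc)
  qed
  \<comment> \<open>The same argument with the two columns exchanged.\<close>
  have greater: "r i j k l = 0" if "j < k" "i + j = k + l" for i j k l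
    using that
  proof (induction j arbitrary: i k l)
    case 0
    with rec[of "i + 1" 0 "k - 1" l] show ?case
      by (cases k) (auto simp flip: of_nat_Suc)
  next
    case (Suc j)
    from Suc.prems Suc.IH[of "k - 1" "i + 1" "l + 1"] have "r (i + 1) j (k - 1) (l + 1) = 0"
      by auto
    with Suc.prems rec[of "i + 1" "Suc j" "k - 1" l] show ?case
      by (cases k) (auto simp flip: of_nat_Suc)
  qed
  show "r i j k l = 0" if "\<not> (i = l \<and> j = k)"
  proof (cases "i + j = k + l")
    case True
    with that have "i < l \<or> j < k" by auto
    with True less greater show ?thesis by blast
  qed (rule weight)
  show "fact (n + m) * r n m m n = (- 1) ^ m * fact n * fact m * r (n + m) 0 0 (n + m)"
  proof (induction m arbitrary: n)
    case (Suc m)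
    \<comment> \<open>One step of the recurrence trades a factor \<open>a\<^sub>2 b\<^sub>1\<close>
      for a factor \<open>a\<^sub>1 b\<^sub>2\<close>, at the cost of -(m+1)/(n+1).\<close>
    have "of_nat (Suc n) * r n (Suc m) (Suc m) n = - of_nat (Suc m) * r (Suc n) m m (Suc n)"
      using rec[of "Suc n" "Suc m" m n] by (simp add: eq_neg_iff_add_eq_0 del: of_nat_Suc)
    then have "fact (Suc n + m) * (of_nat (Suc n) * r n (Suc m) (Suc m) n) =
        fact (Suc n + m) * (- of_nat (Suc m) * r (Suc n) m m (Suc n))"
      by (rule arg_cong)
    then have "of_nat (Suc n) * (fact (n + Suc m) * r n (Suc m) (Suc m) n) =
        - of_nat (Suc m) * (fact (Suc n + m) * r (Suc n) m m (Suc n))"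
      by (simp only: mult.left_commute[of "fact _"] add_Suc add_Suc_right)
    also have "\<dots> = of_nat (Suc n) *
        ((- 1) ^ Suc m * fact n * fact (Suc m) * r (n + Suc m) 0 0 (n + Suc m))"
      unfolding Suc.IH by (simp add: mult_ac del: of_nat_Suc)
    finally show ?case by (simp only: mult_left_cancel[OF of_nat_neq_0])
  qed simp
qed

section \<open>Weights, a torus element and a unipotent element\<close>

definition weight :: "(2 \<times> 2 \<Rightarrow>\<^sub>0 nat) \<Rightarrow> int" where
  "weight m = int (Poly_Mapping.lookup m (1, 1) + Poly_Mapping.lookup m (1, 2)) -
     int (Poly_Mapping.lookup m (2, 1) + Poly_Mapping.lookup m (2, 2))"

lemma weight_add: "weight (m + n) = weight m + weight n"
  by (simp add: weight_def lookup_add)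

lemma weight_expo [simp]: "weight (expo i j k l) = int (i + j) - int (k + l)"
  by (simp add: weight_def)

definition weight_le :: "int \<Rightarrow> 'k::field kY set" where
  "weight_le h = {p. \<forall>m\<in>Poly_Mapping.keys p. weight m \<le> h}"

lemma weight_le_iff: "p \<in> weight_le h \<longleftrightarrow> (\<forall>m. h < weight m \<longrightarrow> Poly_Mapping.lookup p m = 0)"
  by (auto simp: weight_le_def in_keys_iff not_le[symmetric])

lemma weight_le_0 [simp]: "0 \<in> weight_le h"
  by (simp add: weight_le_iff)

lemma weight_le_add: "p \<in> weight_le h \<Longrightarrow> q \<in> weight_le h \<Longrightarrow> p + q \<in> weight_le h"
  by (simp add: weight_le_iff lookup_add)

lemma weight_le_mult:
  assumes "p \<in> weight_le g" "q \<in> weight_le h" "g + h \<le> s"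
  shows "p * q \<in> weight_le s"
  using assms keys_mult[of p q] by (fastforce simp: weight_le_def weight_add)

lemma ymono_weight_le: "ymono i j k l \<in> weight_le (int (i + j) - int (k + l))"
  by (simp add: ymono_eq_single weight_le_def)

definition lowering :: "'k::field kY \<Rightarrow> 'k kY" where
  "lowering p = bvar 1 * pd (1, 1) p + bvar 2 * pd (1, 2) p"

lemma linear_map_lowering: "linear_map lowering"
  by (auto simp: linear_map_def lowering_def pd_add pd_scale distrib_left mult.left_commute)

lemma lowering_mult: "lowering (p * q) = lowering p * q + p * lowering q"
  by (simp add: lowering_def pd_mult algebra_simps)

lemma lowering_ymono: "lowering (ymono i j k l) =
    of_nat i * ymono (i - 1) j (k + 1) l + of_nat j * ymono i (j - 1) k (l + 1)"
  by (simp add: lowering_def pd_mult pd_power algebra_simps)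

text \<open>It sends \<open>a\<^sub>j\<close> to \<open>a\<^sub>j + b\<^sub>j\<close> and fixes
  \<open>b\<^sub>j\<close>, so in characteristic zero it acts as the exponential of
  \<open>lowering\<close>.\<close>

definition unipotent :: "'k::field ^ 2 ^ 2" where
  "unipotent = (\<chi> i j. if i = 2 \<and> j = 1 then 0 else 1)"

text \<open>It scales a monomial of weight w by 2 to the power w. This one element separates weight
  0 from all others, since 2 is not a root of unity in characteristic zero.\<close>

definition torus :: "'k::field ^ 2 ^ 2" where
  "torus = (\<chi> i j. if i \<noteq> j then 0 else if i = 1 then 2 else 1 / 2)"

lemma det_unipotent: "det unipotent = 1"
  by (simp add: det_2 unipotent_def)

lemma det_torus: "det (torus :: 'k::{field,semiring_char_0} ^ 2 ^ 2) = 1"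
  by (simp add: det_2 torus_def)

text \<open>The exponential series of \<open>lowering\<close> cut off after its linear term: each
  application of \<open>lowering\<close> drops the weight by 2, so the rest has weight at most
  \<open>h - 4\<close>.\<close>

definition unipotent_expands :: "int \<Rightarrow> 'k::field kY \<Rightarrow> bool" where
  "unipotent_expands h p \<longleftrightarrow> p \<in> weight_le h \<and> lowering p \<in> weight_le (h - 2) \<and>
     act unipotent p - p - lowering p \<in> weight_le (h - 4)"

text \<open>By the product rule for \<open>lowering\<close>, each leftover term either contains a
  remainder, which loses 4, or is \<open>lowering p * lowering q\<close>, which loses 2
  twice.\<close>

lemma unipotent_expands_mult:
  assumes "unipotent_expands g p" "unipotent_expands h q"
  shows "unipotent_expands (g + h) (p * q)"
proof -
  define x where "x = act unipotent p - p - lowering p"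
  define y where "y = act unipotent q - q - lowering q"
  have act: "act unipotent p = p + lowering p + x" "act unipotent q = q + lowering q + y"
    by (simp_all add: x_def y_def)
  have "act unipotent (p * q) - p * q - lowering (p * q) = lowering p * lowering q +
      p * y + lowering p * y + x * q + x * lowering q + x * y"
    by (simp add: act_mult act lowering_mult algebra_simps)
  moreover have W: "p \<in> weight_le g" "lowering p \<in> weight_le (g - 2)" "x \<in> weight_le (g - 4)"
    "q \<in> weight_le h" "lowering q \<in> weight_le (h - 2)" "y \<in> weight_le (h - 4)"
    using assms by (simp_all add: unipotent_expands_def x_def y_def)
  ultimately show ?thesis
    unfolding unipotent_expands_def lowering_mult
    by (auto intro!: weight_le_add intro: weight_le_mult[OF W(1) W(4)] weight_le_mult[OF W(1) W(5)]
        weight_le_mult[OF W(1) W(6)] weight_le_mult[OF W(2) W(4)] weight_le_mult[OF W(2) W(5)]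
        weight_le_mult[OF W(2) W(6)] weight_le_mult[OF W(3) W(4)] weight_le_mult[OF W(3) W(5)]
        weight_le_mult[OF W(3) W(6)])
qed

lemma unipotent_expands_power:
  assumes "unipotent_expands h p"
  shows "unipotent_expands (int n * h) (p ^ n)"
proof (induction n)
  case 0
  have "1 \<in> weight_le 0" using ymono_weight_le[of 0 0 0 0] by simp
  then show ?case by (simp add: unipotent_expands_def lowering_def)
next
  case (Suc n)
  then show ?case
    using unipotent_expands_mult[OF assms Suc] by (simp add: algebra_simps)
qed

text \<open>For a single variable the expansion is exact, with remainder 0; products preserve
  it.\<close>

lemma unipotent_expands_ymono: "unipotent_expands (int (i + j) - int (k + l)) (ymono i j k l)"
proof -
  have "unipotent_expands 1 (avar j)" "unipotent_expands (- 1) (bvar j)" for j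
    using exhaust_2[of j] ymono_weight_le[of 1 0 0 0] ymono_weight_le[of 0 1 0 0]
      ymono_weight_le[of 0 0 1 0] ymono_weight_le[of 0 0 0 1]
    by (auto simp: unipotent_expands_def lowering_def act_var unipotent_def)
  from this[THEN unipotent_expands_power] have
    "unipotent_expands (int i * 1 + int j * 1 + int k * - 1 + int l * - 1) (ymono i j k l)"
    by (intro unipotent_expands_mult)
  then show ?thesis by (simp add: algebra_simps)
qed

lemma act_torus_ymono:
  "act torus (ymono i j k l :: 'k::{field,semiring_char_0} kY) = Const (2 ^ (i + j) / 2 ^ (k + l)) * ymono i j k l"
proof -
  have "act torus (avar j) = Const (2 :: 'k) * avar j"
    "act torus (bvar j) = Const (1 / 2 :: 'k) * bvar j" for j
    by (simp_all add: act_var torus_def)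
  then have "act torus (ymono i j k l) =
      Const (2 ^ i * 2 ^ j * (1 / 2) ^ k * (1 / 2) ^ l :: 'k) * ymono i j k l"
    by (simp add: act_mult act_power power_mult_distrib Const_mult Const_power mult_ac)
  then show ?thesis
    by (simp add: power_add power_one_over field_simps)
qed

lemma two_power_ratio_eq_1_iff: "(2 :: 'k::{field,semiring_char_0}) ^ a / 2 ^ b = 1 \<longleftrightarrow> a = b"
proof -
  have "(2 :: 'k) ^ a = 2 ^ b \<longleftrightarrow> of_nat (2 ^ a) = (of_nat (2 ^ b) :: 'k)" by simp
  also have "\<dots> \<longleftrightarrow> a = b" by (subst of_nat_eq_iff) simp
  finally show ?thesis by simp
qed

text \<open>The values lie in all of \<open>k[Y]\<close>, so that the locale covers both Reynolds
  operators and the functionals \<open>Omega_coeff N\<close> composed with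
  \<open>Const\<close>.\<close>

locale invariant_map =
  fixes L :: "'k::{field,semiring_char_0} kY \<Rightarrow> 'k kY"
  assumes linear: "linear_map L"
    and act: "\<And>M p. det M = 1 \<Longrightarrow> L (act M p) = L p"
begin

lemma ymono_weight:
  assumes "i + j \<noteq> k + l"
  shows "L (ymono i j k l) = 0"
proof -
  let ?c = "2 ^ (i + j) / 2 ^ (k + l) :: 'k"
  have "Const ?c * L (ymono i j k l) = L (ymono i j k l)"
    using act[OF det_torus, of "ymono i j k l"]
    unfolding act_torus_ymono linear_map_scale[OF linear] .
  then have "(?c - 1) * Poly_Mapping.lookup (L (ymono i j k l)) m = 0" for m
    using lookup_Const_mult[of ?c "L (ymono i j k l)" m] by (simp add: algebra_simps)
  moreover have "?c - 1 \<noteq> 0"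
    using assms two_power_ratio_eq_1_iff[of "i + j" "k + l", where 'k = 'k] by simp
  ultimately show ?thesis
    by (intro poly_mapping_eqI) (metis lookup_zero mult_eq_0_iff)
qed

lemma weight_neg:
  assumes "p \<in> weight_le h" "h < 0"
  shows "L p = 0"
proof -
  have "L (Poly_Mapping.single m 1) = 0" if "m \<in> Poly_Mapping.keys p" for m
  proof -
    obtain i j k l where m: "m = expo i j k l" by (rule expo_cases)
    with assms that have "int (i + j) - int (k + l) < 0"
      by (force simp: weight_le_def)
    then show ?thesis using ymono_weight[of i j k l] by (simp add: m ymono_eq_single)
  qed
  then show ?thesis
    by (subst kY_eq_sum) (simp add: linear_map_sum[OF linear] linear_map_scale[OF linear])
qed

text \<open>The monomial has weight 2, so the remainder of its unipotent expansion has negative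
  weight and is killed by \<open>L\<close>. Invariance cancels the leading terms and leaves only
  \<open>lowering\<close>.\<close>

lemma lowering:
  assumes "i + j = k + l + 2"
  shows "L (lowering (ymono i j k l)) = 0"
proof -
  let ?p = "ymono i j k l :: 'k kY"
  have "act unipotent ?p - ?p - lowering ?p \<in> weight_le (- 2)"
    using unipotent_expands_ymono[of i j k l, where 'a = 'k] assms by (simp add: unipotent_expands_def)
  then have "L (act unipotent ?p - ?p - lowering ?p) = 0"
    by (rule weight_neg) simp
  then show ?thesis
    by (simp add: linear_map_diff[OF linear] act[OF det_unipotent])
qed

lemma recurrence:
  assumes "i + j = k + l + 2"
  shows "of_nat i * Poly_Mapping.lookup (L (ymono (i - 1) j (k + 1) l)) m +
    of_nat j * Poly_Mapping.lookup (L (ymono i (j - 1) k (l + 1))) m = 0"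
proof -
  have "Poly_Mapping.lookup (L (lowering (ymono i j k l))) m = 0"
    by (simp add: lowering[OF assms])
  then show ?thesis
    unfolding lowering_ymono Const_of_nat[symmetric] linear_map_add[OF linear]
      linear_map_scale[OF linear] lookup_add lookup_Const_mult .
qed

lemma ymono_zero: "\<not> (i = l \<and> j = k) \<Longrightarrow> L (ymono i j k l) = 0"
  using lowering_recurrence_zero[of "\<lambda>i j k l. Poly_Mapping.lookup (L (ymono i j k l)) _",
      OF _ recurrence]
  by (intro poly_mapping_eqI) (simp add: ymono_weight)

lemma ymono_balanced: "L (ymono n m m n) =
    Const ((- 1) ^ m * fact n * fact m / fact (n + m)) * L (ymono (n + m) 0 0 (n + m))"
proof (rule poly_mapping_eqI)
  fix x
  have "fact (n + m) * Poly_Mapping.lookup (L (ymono n m m n)) x =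
      (- 1) ^ m * fact n * fact m * Poly_Mapping.lookup (L (ymono (n + m) 0 0 (n + m))) x"
    by (rule lowering_recurrence_balanced[of "\<lambda>i j k l. Poly_Mapping.lookup (L (ymono i j k l)) x",
          OF _ recurrence]) (simp_all add: ymono_weight)
  then show "Poly_Mapping.lookup (L (ymono n m m n)) x = Poly_Mapping.lookup
      (Const ((- 1) ^ m * fact n * fact m / fact (n + m)) * L (ymono (n + m) 0 0 (n + m))) x"
    by (simp add: lookup_Const_mult field_simps)
qed

end

lemma Delta_power: "Delta 1 2 ^ N =
    (\<Sum>k\<le>N. Const (of_nat (N choose k) * (- 1) ^ (N - k)) * ymono k (N - k) (N - k) k)"
proof -
  have "Delta 1 2 ^ N = (avar 1 * bvar 2 + - (avar 2 * bvar 1)) ^ N"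
    by (simp add: Delta_def)
  also have "\<dots> = (\<Sum>k\<le>N. of_nat (N choose k) * (avar 1 * bvar 2) ^ k *
      (- (avar 2 * bvar 1)) ^ (N - k))"
    by (rule binomial_ring)
  also have "\<dots> = (\<Sum>k\<le>N. Const (of_nat (N choose k) * (- 1) ^ (N - k)) * ymono k (N - k) (N - k) k)"
    by (intro sum.cong refl)
      (simp add: power_minus[of "_ * _"] Const_mult Const_of_nat Const_power Const_uminus
        power_mult_distrib mult_ac)
  finally show ?thesis .
qed

text \<open>All N + 1 terms of the binomial expansion contribute equally: the binomial coefficient
  and sign cancel exactly the factor in \<open>ymono_balanced\<close>.\<close>

lemma (in invariant_map) Delta_power: "L (Delta 1 2 ^ N) = Const (of_nat N + 1) * L (ymono N 0 0 N)"
proof -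
  have "L (Const (of_nat (N choose k) * (- 1) ^ (N - k)) * ymono k (N - k) (N - k) k) =
      L (ymono N 0 0 N)" if "k \<le> N" for k
  proof -
    have "of_nat (N choose k) * (fact k * fact (N - k)) = (fact N :: 'k)"
      using binomial_fact_lemma[OF that] by (metis mult.commute of_nat_fact of_nat_mult)
    then have "of_nat (N choose k) * (- 1) ^ (N - k) * ((- 1) ^ (N - k) * fact k * fact (N - k) / fact N)
        = (1 :: 'k)"
      by (simp add: field_simps flip: power_add)
    moreover have "k + (N - k) = N" using that by simp
    ultimately show ?thesis
      unfolding linear_map_scale[OF linear] ymono_balanced[of k "N - k"]
      by (simp only: mult.assoc[symmetric, of "Const _" "Const _"] Const_mult[symmetric])
        simp
  qed
  then have "L (Delta 1 2 ^ N) = (\<Sum>k\<le>N. L (ymono N 0 0 N))"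
    unfolding Delta_power linear_map_sum[OF linear] by (intro sum.cong) auto
  then show ?thesis by (simp add: Const_add Const_of_nat algebra_simps)
qed

lemma (in invariant_map) ymono_eq: "L (ymono n m m n) =
    Const ((- 1) ^ m * fact n * fact m / fact (n + m + 1)) * L (Delta 1 2 ^ (n + m))"
proof -
  have cancel: "A / (c * d) * c = A / d" if "c \<noteq> 0" for A c d :: 'k
    using that by simp
  have "(of_nat (n + m) + 1 :: 'k) \<noteq> 0"
    by (metis Suc_neq_Zero of_nat_Suc of_nat_eq_0_iff add.commute)
  moreover have "fact (n + m + 1) = (of_nat (n + m) + 1) * (fact (n + m) :: 'k)"
    by (simp add: algebra_simps)
  ultimately have "(- 1) ^ m * fact n * fact m / fact (n + m + 1) * (of_nat (n + m) + 1) =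
      ((- 1) ^ m * fact n * fact m / fact (n + m) :: 'k)"
    by (simp only: cancel not_False_eq_True)
  then show ?thesis
    by (simp only: Delta_power ymono_balanced[of n m] mult.assoc[symmetric] Const_mult[symmetric])
qed

subsection \<open>Invariants and the Reynolds operator\<close>

lemma Const_eq_iff [simp]: "Const a = Const b \<longleftrightarrow> a = b"
  by (metis Const_def lookup_single_eq)

lemma Const_eq_0_iff [simp]: "Const a = 0 \<longleftrightarrow> a = 0"
  using Const_eq_iff[of a 0] by (simp del: Const_eq_iff)

lemma act_Delta_power:
  assumes "det M = 1"
  shows "act M (Const c * Delta i j ^ n) = Const c * Delta i j ^ n"
  by (simp add: act_scale act_power act_Delta assms)

lemma act_sum: "act M (sum f A) = (\<Sum>x\<in>A. act M (f x))"
  by (rule linear_map_sum[OF linear_map_act])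

lemma sum_Delta_power_invariant:
  "(\<Sum>n\<in>A. Const (c n) * Delta 1 2 ^ n) \<in> invariants"
  by (simp add: invariants_def SL2_def act_sum act_Delta_power)

section \<open>Coefficients of invariants\<close>

lemma lookup_act_torus:
  fixes p :: "'k::{field,semiring_char_0} kY"
  shows "Poly_Mapping.lookup (act torus p) (expo i j k l) =
    2 ^ (i + j) / 2 ^ (k + l) * Poly_Mapping.lookup p (expo i j k l)"
proof -
  \<comment> \<open>Wrapping scalars in \<open>Const\<close> turns coefficient functionals into maps
    to \<open>k[Y]\<close>, to which \<open>linear_map_eqI\<close> applies.\<close>
  have "Const (Poly_Mapping.lookup (act torus p) (expo i j k l)) =
      Const (2 ^ (i + j) / 2 ^ (k + l) * Poly_Mapping.lookup p (expo i j k l))"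
  proof (rule linear_map_eqI[where
        L = "\<lambda>p. Const (Poly_Mapping.lookup (act torus p) (expo i j k l))" and
        L' = "\<lambda>p. Const (2 ^ (i + j) / 2 ^ (k + l) * Poly_Mapping.lookup p (expo i j k l))"])
    show "linear_map (\<lambda>p :: 'k kY. Const (Poly_Mapping.lookup (act torus p) (expo i j k l)))"
      by (simp add: linear_map_def act_add act_scale lookup_add lookup_Const_mult Const_add Const_mult)
    show "linear_map (\<lambda>p :: 'k kY.
        Const (2 ^ (i + j) / 2 ^ (k + l) * Poly_Mapping.lookup p (expo i j k l)))"
      by (simp only: linear_map_def lookup_add lookup_Const_mult Const_add Const_mult
          distrib_left mult.left_commute) simp
    show "Const (Poly_Mapping.lookup (act torus (ymono a b c d :: 'k kY)) (expo i j k l)) =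
        Const (2 ^ (i + j) / 2 ^ (k + l) * Poly_Mapping.lookup (ymono a b c d) (expo i j k l))"
      for a b c d
      unfolding act_torus_ymono lookup_Const_mult lookup_ymono by auto
  qed
  then show ?thesis by simp
qed

lemma lookup_bvar_mult:
  fixes p :: "'k::field kY"
  shows "Poly_Mapping.lookup (bvar 1 * p) (expo i j k l) =
      (if k = 0 then 0 else Poly_Mapping.lookup p (expo i j (k - 1) l))" (is ?one)
    and "Poly_Mapping.lookup (bvar 2 * p) (expo i j k l) =
      (if l = 0 then 0 else Poly_Mapping.lookup p (expo i j k (l - 1)))" (is ?two)
proof -
  have 1: "linear_map (\<lambda>p :: 'k kY. Const (Poly_Mapping.lookup (bvar s * p) (expo i j k l)))" for s
    by (simp add: linear_map_def lookup_add lookup_Const_mult Const_add Const_mult distrib_left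
        mult.left_commute[of _ "Const _"])
  have 2: "linear_map (\<lambda>p :: 'k kY. Const (if b then 0 else Poly_Mapping.lookup p m))" for b m
    by (simp add: linear_map_def lookup_add lookup_Const_mult Const_add Const_mult)
  have bvar_mult: "bvar 1 * ymono a b c d = ymono a b (c + 1) d"
    "bvar 2 * ymono a b c d = ymono a b c (d + 1)" for a b c d
    by (simp_all add: mult_ac)
  have "Const (Poly_Mapping.lookup (bvar 1 * p) (expo i j k l)) =
      Const (if k = 0 then 0 else Poly_Mapping.lookup p (expo i j (k - 1) l))"
    by (rule linear_map_eqI[OF 1 2]) (auto simp: bvar_mult lookup_ymono simp del: One_nat_def)
  then show ?one by simp
  have "Const (Poly_Mapping.lookup (bvar 2 * p) (expo i j k l)) =
      Const (if l = 0 then 0 else Poly_Mapping.lookup p (expo i j k (l - 1)))"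
    by (rule linear_map_eqI[OF 1 2]) (auto simp: bvar_mult lookup_ymono simp del: One_nat_def)
  then show ?two by simp
qed

lemma lookup_lowering: "Poly_Mapping.lookup (lowering p) (expo i j k l) =
    (if k = 0 then 0 else of_nat (i + 1) * Poly_Mapping.lookup p (expo (i + 1) j (k - 1) l)) +
    (if l = 0 then 0 else of_nat (j + 1) * Poly_Mapping.lookup p (expo i (j + 1) k (l - 1)))"
proof -
  have "expo i j k l + Poly_Mapping.single (1, 1) 1 = expo (i + 1) j k l"
    "expo i j k l + Poly_Mapping.single (1, 2) 1 = expo i (j + 1) k l" for i j k l
    by (simp_all add: expo_iff_lookup lookup_add lookup_single)
  then show ?thesis
    by (simp add: lowering_def lookup_add lookup_bvar_mult lookup_pd del: One_nat_def)
qed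

context
  fixes t :: "'k::{field,semiring_char_0} kY"
  assumes inv: "t \<in> invariants"
begin

lemma invariant_lookup_weight:
  assumes "i + j \<noteq> k + l"
  shows "Poly_Mapping.lookup t (expo i j k l) = 0"
proof -
  have "act torus t = t"
    using inv det_torus by (auto simp: invariants_def SL2_def)
  then have "2 ^ (i + j) / 2 ^ (k + l) * Poly_Mapping.lookup t (expo i j k l) =
      1 * Poly_Mapping.lookup t (expo i j k l)"
    using lookup_act_torus[of t i j k l] by simp
  then show ?thesis
    unfolding mult_cancel_right two_power_ratio_eq_1_iff using assms by blast
qed

text \<open>Since \<open>act unipotent t = t\<close>, the polynomial \<open>lowering t\<close>
  equals \<open>?D t\<close>, the negative of the expansion remainder. All monomials of
  \<open>t\<close> have weight 0, so each contributes weight at most -4.\<close>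

lemma invariant_lowering: "lowering t \<in> weight_le (- 4)"
proof -
  let ?D = "\<lambda>p :: 'k kY. p + lowering p - act unipotent p"
  have D: "linear_map ?D"
    by (simp add: linear_map_def linear_map_add[OF linear_map_lowering] act_add act_scale
        linear_map_scale[OF linear_map_lowering] distrib_left right_diff_distrib)
  have mono: "?D (Poly_Mapping.single m 1) \<in> weight_le (- 4)" if "m \<in> Poly_Mapping.keys t" for m
  proof -
    obtain i j k l where m: "m = expo i j k l" by (rule expo_cases)
    with that have "i + j = k + l"
      using invariant_lookup_weight by (auto simp: in_keys_iff)
    then have "act unipotent (ymono i j k l) - ymono i j k l - lowering (ymono i j k l)
        \<in> (weight_le (- 4) :: 'k kY set)"
      using unipotent_expands_ymono[of i j k l, where 'a = 'k] by (simp add: unipotent_expands_def)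
    then show ?thesis
      by (simp add: m ymono_eq_single weight_le_iff lookup_minus lookup_add)
        (metis add.commute diff_add_cancel diff_eq_diff_eq diff_self)
  qed
  have "?D t = (\<Sum>m\<in>Poly_Mapping.keys t. Const (Poly_Mapping.lookup t m) * ?D (Poly_Mapping.single m 1))"
    using arg_cong[OF kY_eq_sum, of ?D t]
    unfolding linear_map_sum[OF D] linear_map_scale[OF D] .
  also have "\<dots> \<in> weight_le (- 4)"
    using mono by (simp add: weight_le_iff lookup_sum lookup_Const_mult)
  also have "?D t = lowering t"
    using inv det_unipotent by (auto simp: invariants_def SL2_def)
  finally show ?thesis .
qed

text \<open>The part of weight \<open>-2\<close> of \<open>lowering t\<close> vanishes. Multiplying the coefficients by
  factorials and exchanging the rows turns this into the same recurrence that holds for the values of an invariant map on monomials.\<close>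

lemma invariant_recurrence:
  assumes "k + l = i + j + 2"
  defines "r \<equiv> \<lambda>a b c d. fact a * fact b * fact c * fact d * Poly_Mapping.lookup t (expo c d a b)"
  shows "of_nat k * r (k - 1) l (i + 1) j + of_nat l * r k (l - 1) i (j + 1) = 0"
proof -
  have "Poly_Mapping.lookup (lowering t) (expo i j k l) = 0"
    using invariant_lowering assms(1) by (simp add: weight_le_iff)
  \<comment> \<open>The factorials exchange the coefficients: k! i! (i+1) = k (k-1)! (i+1)!, and
    likewise for \<open>l\<close> and \<open>j\<close>.\<close>
  then have "fact k * fact l * fact i * fact j *
    ((if k = 0 then 0 else of_nat (i + 1) * Poly_Mapping.lookup t (expo (i + 1) j (k - 1) l)) +
     (if l = 0 then 0 else of_nat (j + 1) * Poly_Mapping.lookup t (expo i (j + 1) k (l - 1)))) = 0"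
    by (simp add: lookup_lowering)
  then show ?thesis
    by (cases k; cases l) (simp_all add: r_def algebra_simps)
qed

text \<open>The recurrence expresses all coefficients of an invariant through those of the powers of
  \<open>a\<^sub>1 b\<^sub>2\<close>. Applied to a difference, this shows that the latter determine
  the invariant.\<close>

lemma invariant_eq_0:
  assumes "\<And>N. Poly_Mapping.lookup t (expo N 0 0 N) = 0"
  shows "t = 0"
proof -
  define r where
    "r = (\<lambda>a b c d. fact a * fact b * fact c * fact d * Poly_Mapping.lookup t (expo c d a b))"
  have weight: "r i j k l = 0" if "i + j \<noteq> k + l" for i j k l
    using that by (simp add: r_def invariant_lookup_weight)
  have rec: "of_nat i * r (i - 1) j (k + 1) l + of_nat j * r i (j - 1) k (l + 1) = 0"
    if "i + j = k + l + 2" for i j k l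
    using invariant_recurrence[OF that] by (simp add: r_def)
  note zero = lowering_recurrence_zero[of r, OF weight rec]
    and balanced = lowering_recurrence_balanced[of r, OF weight rec]
  \<comment> \<open>Because of the exchanged rows, the hypothesis concerns \<open>r 0 N N 0\<close>;
    the case \<open>n = 0\<close>, \<open>m = N\<close> of \<open>balanced\<close> carries it over
    to \<open>r N 0 0 N\<close>.\<close>
  have "r N 0 0 N = 0" for N
    using balanced[of 0 N] assms[of N] by (auto simp: r_def)
  then have "r n m m n = 0" for n m
    using balanced[of n m] by auto
  with zero have "r i j k l = 0" for i j k l
    by metis
  then have "Poly_Mapping.lookup t (expo i j k l) = 0" for i j k l
    by (simp add: r_def)
  then show ?thesis
    by (metis expo_cases lookup_zero poly_mapping_eqI)
qed

end

lemma lookup_Delta_power: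
  "Poly_Mapping.lookup (Delta 1 2 ^ M) (expo N 0 0 N) = (if M = N then 1 else 0)"
proof -
  have "Poly_Mapping.lookup (Delta 1 2 ^ M :: 'a kY) (expo N 0 0 N) =
      (\<Sum>k\<le>M. if k = N then if M = N then 1 else 0 else 0)"
    unfolding Delta_power lookup_sum lookup_Const_mult lookup_ymono
    by (intro sum.cong) auto
  then show ?thesis by simp
qed

lemma poly_map_poly_Const_sum:
  fixes f :: "'k::field kY"
  shows "poly (map_poly Const (\<Sum>n\<in>A. monom (c n) n)) f = (\<Sum>n\<in>A. Const (c n) * f ^ n)"
proof -
  have "map_poly Const (p + q) = map_poly Const p + (map_poly Const q :: 'k kY poly)" for p q
    by (rule poly_eqI) (simp add: coeff_map_poly Const_add)
  then show ?thesis
    by (induction A rule: infinite_finite_induct) (simp_all add: map_poly_monom poly_monom)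
qed

lemma generated_subalgebraE:
  assumes "p \<in> generated_subalgebra f"
  obtains d c where "p = (\<Sum>n\<le>d. Const (c n) * f ^ n)"
proof -
  from assms obtain q where "p = poly (map_poly Const q) f"
    by (auto simp: generated_subalgebra_def)
  then have "p = (\<Sum>n\<le>degree q. Const (coeff q n) * f ^ n)"
    by (simp flip: poly_map_poly_Const_sum add: poly_as_sum_of_monoms)
  then show ?thesis by (rule that)
qed

lemma invariants_eq: "(invariants :: 'k::{field,semiring_char_0} kY set) = generated_subalgebra (Delta 1 2)"
proof (intro equalityI subsetI)
  fix t :: "'k kY"
  assume t: "t \<in> invariants"
  define A where "A = (\<lambda>m. Poly_Mapping.lookup m (1, 1)) ` Poly_Mapping.keys t"
  define c where "c n = Poly_Mapping.lookup t (expo n 0 0 n)" for n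
  \<comment> \<open>The candidate has the same coefficients as \<open>t\<close> at the powers of
    \<open>a\<^sub>1 b\<^sub>2\<close>, since \<open>Delta 1 2 ^ n\<close> contains exactly one of
    these, with coefficient 1.\<close>
  define s where "s = (\<Sum>n\<in>A. Const (c n) * Delta 1 2 ^ n)"
  have "finite A" by (simp add: A_def)
  have A: "c n = 0" if "n \<notin> A" for n
    using that by (auto simp: A_def c_def image_iff in_keys_iff dest: bspec[where x = "expo n 0 0 n"])
  have "t - s = 0"
  proof (rule invariant_eq_0)
    have "s \<in> invariants" unfolding s_def by (rule sum_Delta_power_invariant)
    with t show "t - s \<in> invariants"
      by (simp add: invariants_def act_diff)
    fix N
    have "Poly_Mapping.lookup s (expo N 0 0 N) = (\<Sum>n\<in>A. if n = N then c n else 0)"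
      unfolding s_def lookup_sum lookup_Const_mult lookup_Delta_power by (intro sum.cong) auto
    also have "\<dots> = c N" using \<open>finite A\<close> A[of N] by simp
    finally show "Poly_Mapping.lookup (t - s) (expo N 0 0 N) = 0"
      by (simp add: lookup_minus c_def)
  qed
  then have "t = poly (map_poly Const (\<Sum>n\<in>A. monom (c n) n)) (Delta 1 2)"
    by (simp add: poly_map_poly_Const_sum s_def)
  then show "t \<in> generated_subalgebra (Delta 1 2)"
    by (auto simp: generated_subalgebra_def)
next
  fix t :: "'k kY"
  assume "t \<in> generated_subalgebra (Delta 1 2)"
  then obtain d c where "t = (\<Sum>n\<le>d. Const (c n) * Delta 1 2 ^ n)"
    by (rule generated_subalgebraE)
  then show "t \<in> invariants" by (simp only: sum_Delta_power_invariant)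
qed

section \<open>Existence of the Reynolds operator by Cayley's construction\<close>

lemma invariant_map_Omega_coeff: "invariant_map (\<lambda>p :: 'k::{field,semiring_char_0} kY. Const (Omega_coeff N p))"
  by unfold_locales
    (simp_all add: linear_map_def Omega_coeff_add Omega_coeff_scale Omega_coeff_act Const_add Const_mult)

text \<open>The formulas for invariant maps express the value on a monomial through the value on
  \<open>Delta 1 2 ^ (i + j)\<close>, or make it 0. So only \<open>N = i + j\<close> can contribute,
  and a polynomial has finitely many monomials.\<close>

lemma finite_Omega_coeff: "finite {N. Omega_coeff N (p :: 'k::{field,semiring_char_0} kY) \<noteq> 0}"
proof -
  have mono: "Omega_coeff N (ymono i j k l :: 'k kY) = 0" if "N \<noteq> i + j" for i j k l N
  proof -
    interpret invariant_map "\<lambda>p :: 'k kY. Const (Omega_coeff N p)"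
      by (rule invariant_map_Omega_coeff)
    have "Const (Omega_coeff N (ymono i j k l :: 'k kY)) = 0"
    proof (cases "i = l \<and> j = k")
      case True
      with that show ?thesis
        using ymono_eq[of i j] by (simp add: Omega_coeff_Delta_power)
    qed (rule ymono_zero)
    then show ?thesis by simp
  qed
  have "Omega_coeff N p = 0" if "N \<notin> (\<lambda>m. Poly_Mapping.lookup m (1, 1) + Poly_Mapping.lookup m (1, 2)) ` Poly_Mapping.keys p" for N
  proof -
    interpret invariant_map "\<lambda>p :: 'k kY. Const (Omega_coeff N p)"
      by (rule invariant_map_Omega_coeff)
    have "Omega_coeff N (Poly_Mapping.single m 1 :: 'k kY) = 0" if "m \<in> Poly_Mapping.keys p" for m
    proof -
      obtain i j k l where m: "m = expo i j k l" by (rule expo_cases)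
      with \<open>N \<notin> _\<close> \<open>m \<in> _\<close> have "N \<noteq> i + j" by force
      then show ?thesis using mono by (simp add: m ymono_eq_single)
    qed
    then have "Const (Omega_coeff N p) = 0"
      by (subst kY_eq_sum) (simp add: linear_map_sum[OF linear] linear_map_scale[OF linear])
    then show ?thesis by simp
  qed
  then have "{N. Omega_coeff N p \<noteq> 0} \<subseteq>
      (\<lambda>m. Poly_Mapping.lookup m (1, 1) + Poly_Mapping.lookup m (1, 2)) ` Poly_Mapping.keys p"
    by blast
  then show ?thesis by (rule finite_subset) simp
qed

text \<open>The denominators are the values of \<open>Omega_coeff N\<close> on
  \<open>Delta 1 2 ^ N\<close>, so that all powers of \<open>Delta 1 2\<close> are fixed.\<close>

definition Cayley_reynolds :: "'k::{field,semiring_char_0} kY \<Rightarrow> 'k kY" where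
  "Cayley_reynolds p = (\<Sum>N | Omega_coeff N p \<noteq> 0.
     Const (Omega_coeff N p / (fact N * fact (N + 1))) * Delta 1 2 ^ N)"

lemma Cayley_reynolds_superset:
  assumes "finite A" "{N. Omega_coeff N p \<noteq> 0} \<subseteq> A"
  shows "Cayley_reynolds p =
    (\<Sum>N\<in>A. Const (Omega_coeff N p / (fact N * fact (N + 1))) * Delta 1 2 ^ N)"
  unfolding Cayley_reynolds_def
  by (rule sum.mono_neutral_left) (use assms in auto)

lemma linear_map_Cayley_reynolds: "linear_map (Cayley_reynolds :: 'k::{field,semiring_char_0} kY \<Rightarrow> 'k kY)"
  unfolding linear_map_def
proof (intro conjI allI)
  fix p q :: "'k kY"
  let ?A = "{N. Omega_coeff N p \<noteq> 0} \<union> {N. Omega_coeff N q \<noteq> 0}"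
  have "finite ?A" by (simp add: finite_Omega_coeff)
  moreover have "{N. Omega_coeff N (p + q) \<noteq> 0} \<subseteq> ?A" by (auto simp: Omega_coeff_add)
  ultimately show "Cayley_reynolds (p + q) = Cayley_reynolds p + Cayley_reynolds q"
    by (simp add: Cayley_reynolds_superset[of ?A] Omega_coeff_add add_divide_distrib Const_add
        distrib_right sum.distrib del: fact_Suc)
next
  fix c and p :: "'k kY"
  let ?A = "{N. Omega_coeff N p \<noteq> 0}"
  have "finite ?A" by (rule finite_Omega_coeff)
  moreover have "{N. Omega_coeff N (Const c * p) \<noteq> 0} \<subseteq> ?A" by (auto simp: Omega_coeff_scale)
  ultimately show "Cayley_reynolds (Const c * p) = Const c * Cayley_reynolds p"
    by (simp add: Cayley_reynolds_superset[of ?A] Omega_coeff_scale sum_distrib_left mult.assoc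
        Const_mult[of c] times_divide_eq_right[symmetric] del: fact_Suc times_divide_eq_right)
qed

lemma Cayley_reynolds_Delta_power:
  "Cayley_reynolds (Delta 1 2 ^ N :: 'k::{field,semiring_char_0} kY) = Delta 1 2 ^ N"
  by (subst Cayley_reynolds_superset[of "{N}"])
    (auto simp: Omega_coeff_Delta_power simp del: fact_Suc)

lemma is_reynolds_Cayley_reynolds: "is_reynolds (Cayley_reynolds :: 'k::{field,semiring_char_0} kY \<Rightarrow> 'k kY)"
  unfolding is_reynolds_def linear_iff_linear_map
proof (intro conjI ballI allI)
  show "range (Cayley_reynolds :: 'k kY \<Rightarrow> 'k kY) \<subseteq> invariants"
    unfolding Cayley_reynolds_def by (rule image_subsetI) (rule sum_Delta_power_invariant)
  show "Cayley_reynolds r = r" if "r \<in> invariants" for r :: "'k kY"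
  proof -
    from that obtain d c where "r = (\<Sum>n\<le>d. Const (c n) * Delta 1 2 ^ n)"
      unfolding invariants_eq by (rule generated_subalgebraE)
    then show ?thesis
      by (simp add: linear_map_sum[OF linear_map_Cayley_reynolds] Cayley_reynolds_Delta_power
          linear_map_scale[OF linear_map_Cayley_reynolds])
  qed
  show "Cayley_reynolds (act M s) = Cayley_reynolds s" if "M \<in> SL2" for M and s :: "'k kY"
    using that by (simp add: Cayley_reynolds_def SL2_def Omega_coeff_act)
qed (rule linear_map_Cayley_reynolds)

section \<open>Uniqueness and values on monomials\<close>

lemma is_reynolds_invariant_map:
  assumes "is_reynolds R"
  shows "invariant_map R"
  using assms by unfold_locales (auto simp: is_reynolds_def linear_iff_linear_map SL2_def)

lemma is_reynolds_Delta_power: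
  fixes R :: "'k::field kY \<Rightarrow> 'k kY"
  assumes "is_reynolds R"
  shows "R (Delta 1 2 ^ N) = Delta 1 2 ^ N"
proof -
  have "Delta 1 2 ^ N \<in> (invariants :: 'k kY set)"
    using sum_Delta_power_invariant[of "\<lambda>_. 1" "{N}"] by simp
  with assms show ?thesis by (simp add: is_reynolds_def)
qed

text \<open>The right-hand side does not involve \<open>R\<close>, so this gives uniqueness as well
  as both parts of the formula.\<close>

lemma is_reynolds_ymono:
  fixes R :: "'k::{field,semiring_char_0} kY \<Rightarrow> 'k kY"
  assumes "is_reynolds R"
  shows "R (ymono i j k l) = (if i = l \<and> j = k
    then Const ((- 1) ^ j * fact i * fact j / fact (i + j + 1)) * Delta 1 2 ^ (i + j) else 0)"
  using invariant_map.ymono_zero[OF is_reynolds_invariant_map[OF assms], of i l j k]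
    invariant_map.ymono_eq[OF is_reynolds_invariant_map[OF assms], of i j]
  by (auto simp: is_reynolds_Delta_power[OF assms])

lemma ex1_is_reynolds: "\<exists>!R :: 'k::{field,semiring_char_0} kY \<Rightarrow> 'k kY. is_reynolds R"
proof (rule ex1I)
  fix R :: "'k kY \<Rightarrow> 'k kY"
  assume R: "is_reynolds R"
  show "R = Cayley_reynolds"
  proof (rule ext, rule linear_map_eqI[where L = R and L' = Cayley_reynolds])
    show "linear_map R" using R by (simp add: is_reynolds_def linear_iff_linear_map)
  qed (simp_all only: linear_map_Cayley_reynolds is_reynolds_ymono[OF R]
      is_reynolds_ymono[OF is_reynolds_Cayley_reynolds])
qed (rule is_reynolds_Cayley_reynolds)

lemma is_reynolds_reynolds: "is_reynolds (reynolds :: 'k::{field,semiring_char_0} kY \<Rightarrow> 'k kY)"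
  unfolding reynolds_def by (rule theI'[OF ex1_is_reynolds])

lemma diagonal_products_eq_ymono:
  "(avar 1 * bvar 2) ^ n * (avar 2 * bvar 1) ^ m = ymono n m m n"
  by (simp add: power_mult_distrib mult_ac)

text \<open>The sign in \<open>is_reynolds_ymono\<close> is absorbed by \<open>Delta 2 1\<close>,
  which is the negative of \<open>Delta 1 2\<close>.\<close>

lemma reynolds_diagonal_products:
  "reynolds ((avar 1 * bvar 2) ^ n * (avar 2 * bvar 1) ^ m :: 'k::{field,semiring_char_0} kY) =
    Const (fact n * fact m / fact (n + m + 1)) * Delta 1 2 ^ n * Delta 2 1 ^ m"
proof -
  have "Delta 2 1 ^ m = Const ((- 1) ^ m) * (Delta 1 2 ^ m :: 'k kY)"
    by (simp add: Delta_def Const_power Const_uminus flip: power_mult_distrib)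
  moreover have "Const ((- 1) ^ m * fact n * fact m / fact (n + m + 1) :: 'k) =
      Const ((- 1) ^ m) * Const (fact n * fact m / fact (n + m + 1))"
    by (simp flip: Const_mult)
  ultimately show ?thesis
    unfolding diagonal_products_eq_ymono is_reynolds_ymono[OF is_reynolds_reynolds]
    by (simp add: power_add mult_ac del: fact_Suc)
qed

theorem theorem7p1:
  fixes \<mu> :: "'k::field_char_0 kY"
  assumes "is_monomial \<mu>"
  shows "(\<exists>!R :: 'k kY \<Rightarrow> 'k kY. is_reynolds R) \<and>
    (invariants :: 'k kY set) = generated_subalgebra (Delta 1 2) \<and>
    (\<forall>n m. \<mu> = (avar 1 * bvar 2) ^ n * (avar 2 * bvar 1) ^ m \<longrightarrow>
       reynolds \<mu> = reynolds ((avar 1 * bvar 2) ^ n * (avar 2 * bvar 1) ^ m) \<and>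
       reynolds ((avar 1 * bvar 2) ^ n * (avar 2 * bvar 1) ^ m) =
         Const (fact n * fact m / fact (n + m + 1)) * Delta 1 2 ^ n * Delta 2 1 ^ m) \<and>
    (\<forall>n. reynolds ((avar 1 * bvar 2 :: 'k kY) ^ n) = Const (1 / (of_nat n + 1)) * Delta 1 2 ^ n) \<and>
    ((\<nexists>n m. \<mu> = (avar 1 * bvar 2) ^ n * (avar 2 * bvar 1) ^ m) \<longrightarrow> reynolds \<mu> = 0)"
proof (intro conjI allI impI)
  show "\<exists>!R :: 'k kY \<Rightarrow> 'k kY. is_reynolds R" by (rule ex1_is_reynolds)
  show "(invariants :: 'k kY set) = generated_subalgebra (Delta 1 2)" by (rule invariants_eq)
next
  fix n
  have "fact n / fact (n + 1) = (1 / (of_nat n + 1) :: 'k)"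
    by (simp add: add.commute)
  then show "reynolds ((avar 1 * bvar 2 :: 'k kY) ^ n) = Const (1 / (of_nat n + 1)) * Delta 1 2 ^ n"
    using reynolds_diagonal_products[of n 0, where 'k = 'k] by (simp del: fact_Suc)
next
  assume not: "\<nexists>n m. \<mu> = (avar 1 * bvar 2) ^ n * (avar 2 * bvar 1) ^ m"
  from assms obtain e :: "2 \<Rightarrow> 2 \<Rightarrow> nat" where "\<mu> = (\<Prod>i\<in>UNIV. \<Prod>j\<in>UNIV. Ymat $ i $ j ^ e i j)"
    unfolding is_monomial_def by blast
  then have \<mu>: "\<mu> = ymono (e 1 1) (e 1 2) (e 2 1) (e 2 2)"
    by (simp add: UNIV_2 mult.assoc)
  with not have "\<not> (e 1 1 = e 2 2 \<and> e 1 2 = e 2 1)"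
    unfolding diagonal_products_eq_ymono by metis
  then show "reynolds \<mu> = 0"
    unfolding \<mu> is_reynolds_ymono[OF is_reynolds_reynolds] by (rule if_not_P)
qed (simp, rule reynolds_diagonal_products)

end
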